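(* Let $\mathcal{DB}=(\mathcal{D},\mathcal{IC})$ be a database. Suppose that $(\mathrm{Insert},\mathrm{Retract})$ is a $\leq_i$-preferred repair of $\mathcal{DB}$. Then there is a $\leq_i$-maximally consistent element $N$ in $\mathcal{M}^{\mathcal{DB}}$ such that $\mathrm{Insert}=\mathrm{Insert}^N$ and $\mathrm{Retract}=\mathrm{Retract}^N$.
   Context: Setting. Fix a first-order language $L$ over a fixed database schema (relation names) and a fixed domain $U$; every element of $U$ has a unique name, quantifiers range over $U$, and equality is identity on $U$. "Atom" means ground atom $P(t)$, with $P$ a relation name and $t$ a tuple over $U$. A database instance is a set of atoms with finite active domain (only finitely many elements of $U$ occur in it). A database is a pair $(\mathcal{D},\mathcal{IC})$ with $\mathcal{D}$ a database instance and $\mathcal{IC}$ (the integrity constraints) a finite set of formulas of $L$. A database to be repaired need not satisfy its integrity constraints. Two-valued semantics. A two-valued valuation assigns $t$ or $f$ to each atom and extends classically to all formulas; a classical (two-valued) model of $\mathcal{IC}$ is such a valuation making all formulas of $\mathcal{IC}$ true. $\mathcal{IC}$ is classically consistent if it has a classical model. For a database instance $\mathcal{D}$, the minimal Herbrand model $\mathcal{H}^{\mathcal{D}}$ assigns $t$ to the atoms in $\mathcal{D}$ and $f$ to all other atoms; $\mathcal{D}\models\mathcal{IC}$ means that $\mathcal{H}^{\mathcal{D}}$ is a model of $\mathcal{IC}$. A database $(\mathcal{D},\mathcal{IC})$ is consistent if $\mathcal{IC}$ is classically consistent and $\mathcal{D}\models\mathcal{IC}$. Repairs. A repair of $(\mathcal{D},\mathcal{IC})$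 is a pair $(\mathrm{Insert},\mathrm{Retract})$ of sets of atoms such that (1) $\mathrm{Insert}\cap\mathcal{D}=\emptyset$, (2) $\mathrm{Retract}\subseteq\mathcal{D}$, (3) $((\mathcal{D}\cup\mathrm{Insert})\setminus\mathrm{Retract},\mathcal{IC})$ is a consistent database (so, in particular, its first component is a database instance). Set-inclusion preference on repairs: $(I',R')\leq_i(I,R)$ iff $I\subseteq I'$ and $R\subseteq R'$. A repair $(I,R)$ of $\mathcal{DB}$ is $\leq_i$-preferred if for every repair $(I',R')$ of $\mathcal{DB}$, $(I,R)\leq_i(I',R')$ implies $(I',R')\leq_i(I,R)$. Three-valued valuations. The truth values are $t,f,\top$. The order $\leq_k$ has $f<_k\top$ and $t<_k\top$, with $t,f$ incomparable; $\oplus$ is the join for $\leq_k$ (so $x\oplus x=x$, and $x\oplus y=\top$ if $x\neq y$). A three-valued valuation assigns a value in $\{t,f,\top\}$ to each atom. For valuations, $\nu\geq_k\mu$ means $\nu(p)\geq_k\mu(p)$ for every atom $p$, and $(\mathcal{H}^{\mathcal{D}}\oplus M)(p)=\mathcal{H}^{\mathcal{D}}(p)\oplus M(p)$. Write $\nu^{x}=\{p \mid p \text{ an atom},\ \nu(p)=x\}$. Further notation. $\mathrm{Insert}^N=N^{\top}\setminus\mathcal{D}$ and $\mathrm{Retract}^N=N^{\top}\cap\mathcal{D}$. $\mathcal{M}^{\mathcal{DB}}=\{N \mid N \text{ is a three-valued valuation with } N\geq_k\mathcal{H}^{\mathcal{D}}\oplus M \text{ for some classical model } M \text{ of } \mathcal{IC}\}$.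 An element $N$ of a set $\mathcal{S}$ of three-valued valuations is $\leq_i$-maximally consistent in $\mathcal{S}$ if there is no $N'\in\mathcal{S}$ with $N'^{\top}\subsetneq N^{\top}$. *)

theory Defs
  imports Main
begin

text \<open>A schema assigns arities to the relation names it contains. The domain \<open>U\<close> is the type
  \<open>'u\<close>; its elements serve as their own names.\<close>

type_synonym 'r schema = "'r \<Rightarrow> nat option"

type_synonym ('r, 'u) atom = "'r \<times> 'u list"

definition atoms :: "'r schema \<Rightarrow> ('r, 'u) atom set" where
  "atoms S = {(P, ts). S P = Some (length ts)}"

datatype 'u fo_term = Var nat | Name 'u

datatype ('r, 'u) form =
    Rel 'r "'u fo_term list"
  | Eq "'u fo_term" "'u fo_term"
  | Neg "('r, 'u) form"
  | Conj "('r, 'u) form" "('r, 'u) form"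
  | Disj "('r, 'u) form" "('r, 'u) form"
  | Impl "('r, 'u) form" "('r, 'u) form"
  | Forall nat "('r, 'u) form"
  | Exists nat "('r, 'u) form"

fun wf_form :: "'r schema \<Rightarrow> ('r, 'u) form \<Rightarrow> bool" where
  "wf_form S (Rel P ts) \<longleftrightarrow> S P = Some (length ts)"
| "wf_form S (Eq s t) \<longleftrightarrow> True"
| "wf_form S (Neg \<phi>) \<longleftrightarrow> wf_form S \<phi>"
| "wf_form S (Conj \<phi> \<psi>) \<longleftrightarrow> wf_form S \<phi> \<and> wf_form S \<psi>"
| "wf_form S (Disj \<phi> \<psi>) \<longleftrightarrow> wf_form S \<phi> \<and> wf_form S \<psi>"
| "wf_form S (Impl \<phi> \<psi>) \<longleftrightarrow> wf_form S \<phi> \<and> wf_form S \<psi>"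
| "wf_form S (Forall x \<phi>) \<longleftrightarrow> wf_form S \<phi>"
| "wf_form S (Exists x \<phi>) \<longleftrightarrow> wf_form S \<phi>"

text \<open>Valuations are total functions on pairs of a relation name and a list. Values at pairs outside
  \<^term>\<open>atoms S\<close> are meaningless: evaluation of formulas that are well-formed over \<^term>\<open>S\<close>, the order on valuations
  and the sets of atoms with a given value do not depend on them.\<close>

type_synonym ('r, 'u) val2 = "('r, 'u) atom \<Rightarrow> bool"

fun eval_term :: "(nat \<Rightarrow> 'u) \<Rightarrow> 'u fo_term \<Rightarrow> 'u" where
  "eval_term e (Var x) = e x"
| "eval_term e (Name u) = u"

fun eval :: "('r, 'u) val2 \<Rightarrow> (nat \<Rightarrow> 'u) \<Rightarrow> ('r, 'u) form \<Rightarrow> bool" where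
  "eval v e (Rel P ts) \<longleftrightarrow> v (P, map (eval_term e) ts)"
| "eval v e (Eq s t) \<longleftrightarrow> eval_term e s = eval_term e t"
| "eval v e (Neg \<phi>) \<longleftrightarrow> \<not> eval v e \<phi>"
| "eval v e (Conj \<phi> \<psi>) \<longleftrightarrow> eval v e \<phi> \<and> eval v e \<psi>"
| "eval v e (Disj \<phi> \<psi>) \<longleftrightarrow> eval v e \<phi> \<or> eval v e \<psi>"
| "eval v e (Impl \<phi> \<psi>) \<longleftrightarrow> (eval v e \<phi> \<longrightarrow> eval v e \<psi>)"
| "eval v e (Forall x \<phi>) \<longleftrightarrow> (\<forall>u. eval v (e(x := u)) \<phi>)"
| "eval v e (Exists x \<phi>) \<longleftrightarrow> (\<exists>u. eval v (e(x := u)) \<phi>)"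

text \<open>Free variables are read universally; for sentences the assignment is irrelevant.\<close>

definition classical_model :: "('r, 'u) val2 \<Rightarrow> ('r, 'u) form set \<Rightarrow> bool" where
  "classical_model v IC \<longleftrightarrow> (\<forall>\<phi>\<in>IC. \<forall>e. eval v e \<phi>)"

definition classically_consistent :: "('r, 'u) form set \<Rightarrow> bool" where
  "classically_consistent IC \<longleftrightarrow> (\<exists>v. classical_model v IC)"

definition active_domain :: "('r, 'u) atom set \<Rightarrow> 'u set" where
  "active_domain D = (\<Union>(P, ts)\<in>D. set ts)"

definition database_instance :: "'r schema \<Rightarrow> ('r, 'u) atom set \<Rightarrow> bool" where
  "database_instance S D \<longleftrightarrow> D \<subseteq> atoms S \<and> finite (active_domain D)"

type_synonym ('r, 'u) db = "('r, 'u) atom set \<times> ('r, 'u) form set"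

fun database :: "'r schema \<Rightarrow> ('r, 'u) db \<Rightarrow> bool" where
  "database S (D, IC) \<longleftrightarrow> database_instance S D \<and> finite IC \<and> (\<forall>\<phi>\<in>IC. wf_form S \<phi>)"

definition herbrand :: "('r, 'u) atom set \<Rightarrow> ('r, 'u) val2" where
  "herbrand D = (\<lambda>p. p \<in> D)"

fun consistent_database :: "'r schema \<Rightarrow> ('r, 'u) db \<Rightarrow> bool" where
  "consistent_database S (D, IC) \<longleftrightarrow>
     database S (D, IC) \<and> classically_consistent IC \<and> classical_model (herbrand D) IC"

type_synonym ('r, 'u) update = "('r, 'u) atom set \<times> ('r, 'u) atom set"

fun repair :: "'r schema \<Rightarrow> ('r, 'u) db \<Rightarrow> ('r, 'u) update \<Rightarrow> bool" where
  "repair S (D, IC) (Ins, Ret) \<longleftrightarrow>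
     Ins \<subseteq> atoms S \<and> Ret \<subseteq> atoms S \<and>
     Ins \<inter> D = {} \<and> Ret \<subseteq> D \<and> consistent_database S ((D \<union> Ins) - Ret, IC)"

text \<open>Note the direction: the larger update is the smaller one in the order, so that preferred
  repairs are maximal in the order and minimal with respect to inclusion.\<close>

fun le_i :: "('r, 'u) update \<Rightarrow> ('r, 'u) update \<Rightarrow> bool" where
  "le_i (Ins', Ret') (Ins, Ret) \<longleftrightarrow> Ins \<subseteq> Ins' \<and> Ret \<subseteq> Ret'"

definition preferred_repair :: "'r schema \<Rightarrow> ('r, 'u) db \<Rightarrow> ('r, 'u) update \<Rightarrow> bool" where
  "preferred_repair S DB R \<longleftrightarrow>
     repair S DB R \<and> (\<forall>R'. repair S DB R' \<longrightarrow> le_i R R' \<longrightarrow> le_i R' R)"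

datatype truth3 = TT | FF | Both

text \<open>The order is the knowledge order, so \<^const>\<open>sup\<close> is its join.\<close>

instantiation truth3 :: semilattice_sup
begin

definition less_eq_truth3 :: "truth3 \<Rightarrow> truth3 \<Rightarrow> bool" where
  "x \<le> y \<longleftrightarrow> x = y \<or> y = Both"

definition less_truth3 :: "truth3 \<Rightarrow> truth3 \<Rightarrow> bool" where
  "x < y \<longleftrightarrow> x \<noteq> Both \<and> y = Both"

definition sup_truth3 :: "truth3 \<Rightarrow> truth3 \<Rightarrow> truth3" where
  "sup x y = (if x = y then x else Both)"

instance
  by standard (auto simp: less_eq_truth3_def less_truth3_def sup_truth3_def)

end

type_synonym ('r, 'u) val3 = "('r, 'u) atom \<Rightarrow> truth3"

definition embed :: "('r, 'u) val2 \<Rightarrow> ('r, 'u) val3" where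
  "embed v = (\<lambda>p. if v p then TT else FF)"

definition ge_k :: "'r schema \<Rightarrow> ('r, 'u) val3 \<Rightarrow> ('r, 'u) val3 \<Rightarrow> bool" where
  "ge_k S \<nu> \<mu> \<longleftrightarrow> (\<forall>p\<in>atoms S. \<nu> p \<ge> \<mu> p)"

definition atoms_with :: "'r schema \<Rightarrow> ('r, 'u) val3 \<Rightarrow> truth3 \<Rightarrow> ('r, 'u) atom set" where
  "atoms_with S \<nu> x = {p \<in> atoms S. \<nu> p = x}"

definition insert_of :: "'r schema \<Rightarrow> ('r, 'u) atom set \<Rightarrow> ('r, 'u) val3 \<Rightarrow> ('r, 'u) atom set" where
  "insert_of S D N = atoms_with S N Both - D"

definition retract_of :: "'r schema \<Rightarrow> ('r, 'u) atom set \<Rightarrow> ('r, 'u) val3 \<Rightarrow> ('r, 'u) atom set" where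
  "retract_of S D N = atoms_with S N Both \<inter> D"

fun three_valued_models :: "'r schema \<Rightarrow> ('r, 'u) db \<Rightarrow> ('r, 'u) val3 set" where
  "three_valued_models S (D, IC) =
     {N. \<exists>M. classical_model M IC \<and> ge_k S N (\<lambda>p. sup (embed (herbrand D) p) (embed M p))}"

definition maximally_consistent ::
  "'r schema \<Rightarrow> ('r, 'u) val3 set \<Rightarrow> ('r, 'u) val3 \<Rightarrow> bool" where
  "maximally_consistent S X N \<longleftrightarrow>
     N \<in> X \<and> \<not> (\<exists>N'\<in>X. atoms_with S N' Both \<subset> atoms_with S N Both)"

end

theory Submission
  imports Defs
begin

text \<open>The inconsistent atoms of \<open>\<H>\<^sup>D \<oplus> M\<close> are those on which \<open>M\<close> differs from \<open>D\<close>. Hence, for the repaired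
  instance \<open>M\<close>, they form \<open>Insert \<union> Retract\<close>. If another element of \<open>\<M>\<close>, above \<open>\<H>\<^sup>D \<oplus> M\<close>, had strictly
  fewer inconsistent atoms, then \<open>M\<close> would differ from \<open>D\<close> only within \<open>Insert \<union> Retract\<close>; so its true
  atoms would have finite active domain and would yield a repair contradicting preference.\<close>

lemma eval_cong_atoms:
  assumes "\<And>p. p \<in> atoms S \<Longrightarrow> v p = w p" and "wf_form S \<phi>"
  shows "eval v e \<phi> = eval w e \<phi>"
  using assms(2) by (induction \<phi> arbitrary: e) (auto simp: assms(1) atoms_def)

text \<open>A well-formed formula consults a valuation only inside \<open>atoms S\<close>, since
  evaluating arguments preserves arity. So a model may be replaced by the Herbrand valuation of its
  true genuine atoms.\<close>

lemma classical_model_cong_atoms: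
  assumes "\<And>p. p \<in> atoms S \<Longrightarrow> v p = w p" and "\<forall>\<phi>\<in>IC. wf_form S \<phi>"
  shows "classical_model v IC \<longleftrightarrow> classical_model w IC"
  using eval_cong_atoms[of S v w] assms unfolding classical_model_def by blast

lemma active_domain_mono: "A \<subseteq> B \<Longrightarrow> active_domain A \<subseteq> active_domain B"
  unfolding active_domain_def by blast

lemma active_domain_Un: "active_domain (A \<union> B) = active_domain A \<union> active_domain B"
  unfolding active_domain_def by blast

lemma database_instance_subset:
  "database_instance S B \<Longrightarrow> A \<subseteq> B \<Longrightarrow> database_instance S A"
  unfolding database_instance_def by (meson active_domain_mono finite_subset subset_trans)

lemma database_instance_Un:
  "database_instance S A \<Longrightarrow> database_instance S B \<Longrightarrow> database_instance S (A \<union> B)"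
  unfolding database_instance_def by (simp add: active_domain_Un)

text \<open>\<open>repair\<close> bounds the active domain only after retraction. Retracted atoms
  come from \<open>D\<close>, so uniting the repaired instance with \<open>D\<close> recovers all of
  \<open>Ins\<close>.\<close>

lemma database_instance_repaired_Un:
  assumes "database S (D, IC)" and "repair S (D, IC) (Ins, Ret)"
  shows "database_instance S (D \<union> Ins)"
proof -
  have "database_instance S (D \<union> ((D \<union> Ins) - Ret))"
    using assms by (intro database_instance_Un) auto
  then show ?thesis
    using assms(2) by (elim database_instance_subset) auto
qed

lemma repair_of_instance:
  assumes "database S (D, IC)" and "database_instance S D'"
    and "classical_model (herbrand D') IC"
  shows "repair S (D, IC) (D' - D, D - D')"
proof -
  have "(D \<union> (D' - D)) - (D - D') = D'"
    by blast
  then show ?thesis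
    using assms by (auto simp: database_instance_def classically_consistent_def)
qed

lemma sup_embed_eq_Both_iff: "sup (embed v p) (embed w p) = Both \<longleftrightarrow> v p \<noteq> w p"
  by (simp add: embed_def sup_truth3_def)

text \<open>\<open>Both\<close> is the top of the order, so a valuation above the join must keep it
  wherever \<open>v\<close> and \<open>w\<close> differ.\<close>

lemma ge_k_disagreement:
  assumes "ge_k S N (\<lambda>p. sup (embed v p) (embed w p))"
  shows "{p \<in> atoms S. v p \<noteq> w p} \<subseteq> atoms_with S N Both"
proof
  fix p
  assume "p \<in> {p \<in> atoms S. v p \<noteq> w p}"
  then have "p \<in> atoms S" "sup (embed v p) (embed w p) = Both"
    by (simp_all add: sup_embed_eq_Both_iff)
  moreover from this assms have "Both \<le> N p"
    unfolding ge_k_def by metis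
  ultimately show "p \<in> atoms_with S N Both"
    by (auto simp: less_eq_truth3_def atoms_with_def)
qed

theorem proposition6:
  fixes S :: "'r schema"
    and D Ins Ret :: "('r, 'u) atom set"
    and IC :: "('r, 'u) form set"
  assumes "database S (D, IC)"
    and "preferred_repair S (D, IC) (Ins, Ret)"
  shows "\<exists>N. maximally_consistent S (three_valued_models S (D, IC)) N \<and>
             Ins = insert_of S D N \<and> Ret = retract_of S D N"
proof -
  have repair: "repair S (D, IC) (Ins, Ret)"
    and preferred: "\<And>R. repair S (D, IC) R \<Longrightarrow> le_i (Ins, Ret) R \<Longrightarrow> le_i R (Ins, Ret)"
    using assms(2) unfolding preferred_repair_def by blast+
  define E where "E = (D \<union> Ins) - Ret"
  define N where "N = (\<lambda>p. sup (embed (herbrand D) p) (embed (herbrand E) p))"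
  have sub: "Ins \<subseteq> atoms S" "Ret \<subseteq> atoms S" "Ins \<inter> D = {}" "Ret \<subseteq> D"
    and model: "classical_model (herbrand E) IC"
    using repair by (auto simp: E_def)
  have Both_N: "atoms_with S N Both = Ins \<union> Ret"
    using sub by (auto simp: atoms_with_def N_def sup_embed_eq_Both_iff herbrand_def E_def)
  have "ge_k S N (\<lambda>p. sup (embed (herbrand D) p) (embed (herbrand E) p))"
    by (simp add: ge_k_def N_def)
  then have "N \<in> three_valued_models S (D, IC)"
    using model by auto
  moreover have "\<not> atoms_with S N' Both \<subset> Ins \<union> Ret"
    if N': "N' \<in> three_valued_models S (D, IC)" for N'
  proof
    assume less: "atoms_with S N' Both \<subset> Ins \<union> Ret"
    from N' obtain M where M: "classical_model M IC"
      and ge: "ge_k S N' (\<lambda>p. sup (embed (herbrand D) p) (embed M p))"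
      by auto
    \<comment> \<open>\<open>M\<close> may hold at pairs violating the schema; these are dropped to
      get a candidate instance.\<close>
    define D' where "D' = {p \<in> atoms S. M p}"
    have D_atoms: "D \<subseteq> atoms S"
      using assms(1) by (simp add: database_instance_def)
    have "{p \<in> atoms S. herbrand D p \<noteq> M p} = (D' - D) \<union> (D - D')"
      using D_atoms by (auto simp: herbrand_def D'_def)
    with ge_k_disagreement[OF ge] have diff: "(D' - D) \<union> (D - D') \<subseteq> atoms_with S N' Both"
      by simp
    \<comment> \<open>Membership in \<open>D\<close> separates the two parts: \<open>Ret\<close>
      lies inside \<open>D\<close> and \<open>Ins\<close> outside it.\<close>
    with less have le: "D' - D \<subseteq> Ins" "D - D' \<subseteq> Ret"
      using sub by blast+
    have "database_instance S D'"
      using database_instance_repaired_Un[OF assms(1) repair] le(1)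
      by (elim database_instance_subset) blast
    moreover have "classical_model (herbrand D') IC"
      using M assms(1) classical_model_cong_atoms[of S "herbrand D'" M IC]
      by (simp add: herbrand_def D'_def)
    ultimately have "repair S (D, IC) (D' - D, D - D')"
      by (rule repair_of_instance[OF assms(1)])
    \<comment> \<open>By the reversed direction of \<open>le_i\<close>, the inclusions
      \<open>le\<close> are the premise of preference, and its conclusion forces equality of the two
      updates.\<close>
    from preferred[OF this] le have "Ins \<subseteq> D' - D" "Ret \<subseteq> D - D'"
      by simp_all
    with diff less show False
      by blast
  qed
  ultimately have "maximally_consistent S (three_valued_models S (D, IC)) N"
    by (auto simp: maximally_consistent_def Both_N)
  moreover have "Ins = insert_of S D N" "Ret = retract_of S D N"
    using sub by (auto simp: insert_of_def retract_of_def Both_N)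
  ultimately show ?thesis
    by blast
qed

end
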